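(* Let $n\geq 1$ and let $M$ be a finite monoid. Then $$|E(M\wr\mathcal T_n)|=\sum_{k=1}^n \binom nk \sum_{e_1,\ldots,e_k\in E(M)}\left(\sum_{i=1}^k|Me_i|\right)^{n-k},$$ where the inner sum is over all $k$-tuples $(e_1,\ldots,e_k)$ of (not necessarily distinct) idempotents of $M$.
   Context: $\mathcal T_n$ is the full transformation monoid on $\{1,\ldots,n\}$: all maps $\{1,\ldots,n\}\to\{1,\ldots,n\}$, written on the right of their arguments and composed from left to right. The wreath product $M\wr\mathcal T_n$ is the set $M^n\times\mathcal T_n$ with product $$((a_1,\ldots,a_n),\alpha)((b_1,\ldots,b_n),\beta)=((a_1b_{1\alpha},\ldots,a_nb_{n\alpha}),\alpha\beta).$$ For a semigroup $T$, $E(T)=\{x\in T:x^2=x\}$. For $e\in M$, $Me=\{xe:x\in M\}$. *)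

theory Defs
  imports "HOL-Algebra.Coset" "HOL-Library.FuncSet"
begin

text \<open>
  Tuples \<open>(a\<^sub>1, \<dots>, a\<^sub>n)\<close> and self-maps of \<open>{1..n}\<close> are extensional functions on \<open>{1..n}\<close>
  (value \<^const>\<open>undefined\<close> outside), so that equality of functions is equality on \<open>{1..n}\<close> and
  cardinalities are the intended ones.
\<close>

text \<open>Maps act on the right, so the product of \<open>\<alpha>\<close> and \<open>\<beta>\<close> applies \<open>\<alpha>\<close> first.\<close>

definition full_transformation_monoid :: "nat \<Rightarrow> (nat \<Rightarrow> nat) monoid" where
  "full_transformation_monoid n =
    \<lparr>carrier = {1..n} \<rightarrow>\<^sub>E {1..n},
     mult = (\<lambda>\<alpha> \<beta>. \<lambda>i\<in>{1..n}. \<beta> (\<alpha> i)),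
     one = (\<lambda>i\<in>{1..n}. i)\<rparr>"

definition wreath_product ::
    "('a, 'b) monoid_scheme \<Rightarrow> nat \<Rightarrow> ((nat \<Rightarrow> 'a) \<times> (nat \<Rightarrow> nat)) monoid" where
  "wreath_product M n =
    \<lparr>carrier = ({1..n} \<rightarrow>\<^sub>E carrier M) \<times> carrier (full_transformation_monoid n),
     mult = (\<lambda>(a, \<alpha>) (b, \<beta>).
       (\<lambda>i\<in>{1..n}. a i \<otimes>\<^bsub>M\<^esub> b (\<alpha> i), \<alpha> \<otimes>\<^bsub>full_transformation_monoid n\<^esub> \<beta>)),
     one = (\<lambda>i\<in>{1..n}. \<one>\<^bsub>M\<^esub>, \<one>\<^bsub>full_transformation_monoid n\<^esub>)\<rparr>"

definition idempotents :: "('a, 'b) monoid_scheme \<Rightarrow> 'a set" where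
  "idempotents T = {x \<in> carrier T. x \<otimes>\<^bsub>T\<^esub> x = x}"

lemma monoid_full_transformation_monoid: "monoid (full_transformation_monoid n)"
  by (rule monoidI)
    (auto simp: full_transformation_monoid_def PiE_iff extensional_def fun_eq_iff)

lemma monoid_wreath_product:
  assumes "monoid M"
  shows "monoid (wreath_product M n)"
proof -
  interpret monoid M by fact
  show ?thesis
    by (rule monoidI)
      (auto simp: wreath_product_def full_transformation_monoid_def PiE_iff extensional_def
        fun_eq_iff m_assoc)
qed

end

theory Submission imports Defs begin

text \<open>
  A pair \<open>(a, \<alpha>)\<close> is idempotent iff \<open>\<alpha>\<close> is idempotent and \<open>a\<^sub>i a\<^bsub>i\<alpha>\<^esub> = a\<^sub>i\<close> for all \<open>i\<close>. Writing \<open>K\<close>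
  for the image of \<open>\<alpha>\<close>, this says that \<open>\<alpha>\<close> fixes \<open>K\<close> pointwise, that \<open>a\<^sub>j\<close> is idempotent for
  \<open>j \<in> K\<close>, and that every \<open>i \<notin> K\<close> is sent to some \<open>j \<in> K\<close> with \<open>a\<^sub>i \<in> M a\<^sub>j\<close>. So once \<open>K\<close> and
  \<open>(a\<^sub>j)\<^bsub>j \<in> K\<^esub>\<close> are chosen, each \<open>i \<notin> K\<close> independently has \<open>\<Sum>\<^bsub>j \<in> K\<^esub> |M a\<^sub>j|\<close> possibilities for
  the pair \<open>(i\<alpha>, a\<^sub>i)\<close>.
\<close>

text \<open>The coset \<open>carrier G #> e\<close> is the left ideal Ge, and right multiplication
  by an idempotent \<open>e\<close> retracts the monoid onto it.\<close>

lemma (in monoid) mem_r_coset_idempotent_iff: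
  assumes "e \<in> idempotents G"
  shows "x \<in> carrier G #> e \<longleftrightarrow> x \<in> carrier G \<and> x \<otimes> e = x"
  using assms by (auto simp: r_coset_def idempotents_def m_assoc) metis

lemma mem_idempotents_wreath_product_iff:
  "(a, \<alpha>) \<in> idempotents (wreath_product M n) \<longleftrightarrow>
    a \<in> {1..n} \<rightarrow>\<^sub>E carrier M \<and> \<alpha> \<in> {1..n} \<rightarrow>\<^sub>E {1..n} \<and>
    (\<forall>i\<in>{1..n}. a i \<otimes>\<^bsub>M\<^esub> a (\<alpha> i) = a i \<and> \<alpha> (\<alpha> i) = \<alpha> i)"
  by (auto simp: idempotents_def wreath_product_def full_transformation_monoid_def
      PiE_iff extensional_def fun_eq_iff restrict_def)

text \<open>The last component takes values in a disjoint union, not a plain one: an element may lie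
  in several of the ideals, so the index \<open>j\<close>, which is the image of \<open>i\<close>,
  has to be recorded with it.\<close>

lemma (in monoid) bij_betw_idempotents_wreath_product:
  fixes n :: nat
  defines "S \<equiv> SIGMA K : Pow {1..n}. SIGMA e : K \<rightarrow>\<^sub>E idempotents G.
    ({1..n} - K) \<rightarrow>\<^sub>E (SIGMA j : K. carrier G #> e j)"
  shows "bij_betw
    (\<lambda>(a, \<alpha>). (\<alpha> ` {1..n}, restrict a (\<alpha> ` {1..n}), \<lambda>i\<in>{1..n} - \<alpha> ` {1..n}. (\<alpha> i, a i)))
    (idempotents (wreath_product G n)) S"
proof (rule bij_betw_byWitness[where f' = "\<lambda>(K, e, g).
    (\<lambda>i\<in>{1..n}. if i \<in> K then e i else snd (g i), \<lambda>i\<in>{1..n}. if i \<in> K then i else fst (g i))"],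
    goal_cases)
  case 1
  \<comment> \<open>An idempotent \<open>\<alpha>\<close> is the identity on its image, so only its
    values off the image need storing.\<close>
  then show ?case
    by (auto simp: mem_idempotents_wreath_product_iff PiE_iff extensional_def fun_eq_iff)
next
  case 2
  show ?case
  proof (clarify, goal_cases)
    case (1 K e g)
    then have K: "K \<subseteq> {1..n}" and e: "e \<in> K \<rightarrow>\<^sub>E idempotents G"
      and g: "g \<in> ({1..n} - K) \<rightarrow>\<^sub>E (SIGMA j : K. carrier G #> e j)"
      by (auto simp: S_def)
    \<comment> \<open>The rebuilt map fixes \<open>K\<close> pointwise and sends all other points
      into \<open>K\<close>; hence its image gives back \<open>K\<close>.\<close>
    have "fst (g i) \<in> K" if "i \<in> {1..n} - K" for i
      using PiE_mem[OF g that] by auto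
    then have img: "(\<lambda>i\<in>{1..n}. if i \<in> K then i else fst (g i)) ` {1..n} = K"
      using K by (force simp: image_iff)
    \<comment> \<open>Equality of extensional functions is tested outside {1..n} too, where both
      sides take the default value.\<close>
    have "e i = undefined" if "i \<notin> {1..n}" for i
      using PiE_arb[OF e] K that by blast
    then show ?case
      unfolding prod.case img using K e g
      by (auto simp: PiE_iff extensional_def fun_eq_iff)
  qed
next
  case 3
  show ?case
  proof (clarify, goal_cases)
    case (1 K e g a \<alpha>)
    then have a: "a i \<in> carrier G" "a i \<otimes> a (\<alpha> i) = a i"
      and \<alpha>: "\<alpha> i \<in> {1..n}" "\<alpha> (\<alpha> i) = \<alpha> i" if "i \<in> {1..n}" for i
      using that by (auto simp: mem_idempotents_wreath_product_iff)
    \<comment> \<open>This is the equation for \<open>a\<close> at the point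
      \<open>\<alpha> i\<close>, which \<open>\<alpha>\<close> fixes.\<close>
    have idem: "a (\<alpha> i) \<in> idempotents G" if "i \<in> {1..n}" for i
      using a[of "\<alpha> i"] \<alpha>[OF that] by (simp add: idempotents_def)
    then have "a i \<in> carrier G #> a (\<alpha> i)" if "i \<in> {1..n}" for i
      using a that by (simp add: mem_r_coset_idempotent_iff)
    then have "restrict a (\<alpha> ` {1..n}) \<in> \<alpha> ` {1..n} \<rightarrow>\<^sub>E idempotents G"
      and "(\<lambda>i\<in>{1..n} - \<alpha> ` {1..n}. (\<alpha> i, a i)) \<in> ({1..n} - \<alpha> ` {1..n}) \<rightarrow>\<^sub>E
        (SIGMA j : \<alpha> ` {1..n}. carrier G #> restrict a (\<alpha> ` {1..n}) j)"
      and "\<alpha> ` {1..n} \<subseteq> {1..n}"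
      using idem \<alpha>(1) by auto
    then show ?case
      using 1 by (simp add: S_def)
  qed
next
  case 4
  show ?case
  proof (clarify, goal_cases)
    case (1 a \<alpha> K e g)
    then have K: "K \<subseteq> {1..n}" and e: "e \<in> K \<rightarrow>\<^sub>E idempotents G"
      and g: "g \<in> ({1..n} - K) \<rightarrow>\<^sub>E (SIGMA j : K. carrier G #> e j)"
      by (auto simp: S_def)
    have gi: "fst (g i) \<in> K \<and> snd (g i) \<in> carrier G \<and> snd (g i) \<otimes> e (fst (g i)) = snd (g i)"
      if "i \<in> {1..n}" "i \<notin> K" for i
    proof -
      have "fst (g i) \<in> K" "snd (g i) \<in> carrier G #> e (fst (g i))"
        using PiE_mem[OF g, of i] that by auto
      then show ?thesis
        using PiE_mem[OF e] mem_r_coset_idempotent_iff by blast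
    qed
    have ei: "e j \<in> carrier G \<and> e j \<otimes> e j = e j" if "j \<in> K" for j
      using PiE_mem[OF e that] by (auto simp: idempotents_def)
    have fK: "fst (g i) \<in> {1..n}" if "i \<in> {1..n}" "i \<notin> K" for i
      using gi[OF that] K by blast
    show ?case
      using gi ei K fK by (auto simp: mem_idempotents_wreath_product_iff)
  qed
qed

text \<open>Precomposition with \<open>h\<close> matches the two families of tuples and only
  permutes the terms of the inner sum. This lets {1..k} replace any index set of size k.\<close>

lemma sum_PiE_reindex:
  assumes h: "bij_betw h J K"
  shows "(\<Sum>e \<in> K \<rightarrow>\<^sub>E A. F (\<Sum>i\<in>K. c (e i))) = (\<Sum>e \<in> J \<rightarrow>\<^sub>E A. F (\<Sum>i\<in>J. c (e i)))"
proof (rule sum.reindex_bij_witness[where i = "\<lambda>e. \<lambda>k\<in>K. e (inv_into J h k)"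
      and j = "\<lambda>e. \<lambda>j\<in>J. e (h j)"], goal_cases)
  case (1 e)
  then show ?case
    using h bij_betwE[OF bij_betw_inv_into[OF h]]
    by (auto simp: fun_eq_iff PiE_iff extensional_def bij_betw_inv_into_right)
next
  case (2 e)
  then show ?case using h by (auto simp: PiE_iff bij_betw_def)
next
  case (3 e)
  then show ?case
    using h by (auto simp: fun_eq_iff PiE_iff extensional_def bij_betw_inv_into_left
        dest: bij_betwE)
next
  case (4 e)
  then show ?case
    using bij_betwE[OF bij_betw_inv_into[OF h]] by (auto simp: PiE_iff)
next
  case (5 e)
  show ?case
    using sum.reindex_bij_betw[OF h, of "\<lambda>i. c (e i)"] by simp
qed

lemma sum_Pow_card:
  fixes f :: "nat \<Rightarrow> nat"
  assumes "finite A"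
  shows "(\<Sum>K\<in>Pow A. f (card K)) = (\<Sum>k\<le>card A. (card A choose k) * f k)"
proof -
  have "(\<Sum>K\<in>Pow A. f (card K)) = (\<Sum>k\<le>card A. \<Sum>K | K \<in> Pow A \<and> card K = k. f (card K))"
    using assms by (intro sum.group[symmetric]) (auto simp: card_mono)
  also have "\<dots> = (\<Sum>k\<le>card A. (card A choose k) * f k)"
    using n_subsets[OF assms] by (intro sum.cong) auto
  finally show ?thesis .
qed

theorem proposition4p3:
  fixes M :: "('a, 'b) monoid_scheme" and n :: nat
  assumes "n \<ge> 1" and "monoid M" and "finite (carrier M)"
  shows "card (idempotents (wreath_product M n)) =
    (\<Sum>k = 1..n. (n choose k) *
      (\<Sum>e \<in> {1..k} \<rightarrow>\<^sub>E idempotents M.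
        (\<Sum>i = 1..k. card (carrier M #>\<^bsub>M\<^esub> e i)) ^ (n - k)))"
proof -
  interpret monoid M by fact
  have fin_E: "finite (idempotents M)"
    using assms(3) by (simp add: idempotents_def)
  have fin_coset: "finite (carrier M #>\<^bsub>M\<^esub> x)" for x
    using assms(3) by (simp add: r_coset_def)
  define c where "c x = card (carrier M #>\<^bsub>M\<^esub> x)" for x
  define f where "f k = (\<Sum>e \<in> {1..k} \<rightarrow>\<^sub>E idempotents M. (\<Sum>i = 1..k. c (e i)) ^ (n - k))" for k
  have fin_K: "finite K" if "K \<in> Pow {1..n}" for K
    using that finite_subset by auto
  have "card (idempotents (wreath_product M n)) =
      card (SIGMA K : Pow {1..n}. SIGMA e : K \<rightarrow>\<^sub>E idempotents M.
        ({1..n} - K) \<rightarrow>\<^sub>E (SIGMA j : K. carrier M #>\<^bsub>M\<^esub> e j))"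
    by (rule bij_betw_same_card[OF bij_betw_idempotents_wreath_product])
  also have "\<dots> = (\<Sum>K\<in>Pow {1..n}. \<Sum>e \<in> K \<rightarrow>\<^sub>E idempotents M. (\<Sum>j\<in>K. c (e j)) ^ (n - card K))"
    using fin_E fin_coset fin_K
    by (simp add: card_SigmaI finite_PiE card_PiE card_Diff_subset c_def)
  also have "\<dots> = (\<Sum>K\<in>Pow {1..n}. f (card K))"
  proof (rule sum.cong[OF refl])
    fix K assume "K \<in> Pow {1..n}"
    then obtain h where "bij_betw h {1..card K} K"
      using fin_K ex_bij_betw_nat_finite_1 by blast
    then show "(\<Sum>e \<in> K \<rightarrow>\<^sub>E idempotents M. (\<Sum>j\<in>K. c (e j)) ^ (n - card K)) = f (card K)"
      unfolding f_def by (rule sum_PiE_reindex)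
  qed
  also have "\<dots> = (\<Sum>k\<le>n. (n choose k) * f k)"
    using sum_Pow_card[of "{1..n}" f] by simp
  also have "\<dots> = (\<Sum>k = 1..n. (n choose k) * f k)"
  proof (rule sum.mono_neutral_right)
    \<comment> \<open>For k = 0 the only tuple is the empty one, whose inner sum is 0, and 0 ^ n = 0
      because n is positive.\<close>
    show "\<forall>k \<in> {..n} - {1..n}. (n choose k) * f k = 0"
      using assms(1) by (auto simp: f_def not_le Suc_le_eq)
  qed auto
  finally show ?thesis
    by (simp add: f_def c_def)
qed

end
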